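(* Let $n\ge 2$ be an integer and let $\mathcal{H}$ be a symmetric and complete hypothesis set for $n$-class classification. Let $\Phi\colon\mathbb{R}\to\mathbb{R}_+$ be a non-increasing function. Assume that $\Phi$ is convex, twice continuously differentiable, and satisfies $\Phi'(u)<0$ and $\Phi''(u)>0$ for any $u\in(0,\frac12]$. Let $\mathcal{T}$ be the $\mathcal{H}$-estimation error transformation function of the comp-sum loss associated with $\Phi$, that is, for $t\in[0,1]$, $$\mathcal{T}(t)=\inf_{\tau\in[\frac1n,\frac12]}\ \sup_{|u|\le\tau}\left\{\Phi(\tau)-\frac{1-t}{2}\Phi(\tau+u)-\frac{1+t}{2}\Phi(\tau-u)\right\}.$$ Then $\mathcal{T}(t)=\Theta(t^2)$; that is, there exist constants $C>0$, $c>0$, $T>0$ such that $Ct^2\ge\mathcal{T}(t)\ge ct^2$ for all $0<t\le T$.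
   Context: Multi-class classification: input space $\mathcal{X}$, label space $\mathcal{Y}=\{1,\ldots,n\}$; a hypothesis is a measurable function $h\colon\mathcal{X}\times\mathcal{Y}\to\mathbb{R}$. The comp-sum loss associated with $\Phi$ is $\ell^{\rm comp}(h,x,y)=\Phi\left(\frac{e^{h(x,y)}}{\sum_{y'\in\mathcal{Y}}e^{h(x,y')}}\right)$. $\mathcal{H}$ is symmetric if there is a family $\mathcal{F}$ of functions $\mathcal{X}\to\mathbb{R}$ such that $\{[h(x,1),\ldots,h(x,n)]\colon h\in\mathcal{H}\}=\{[f_1(x),\ldots,f_n(x)]\colon f_1,\ldots,f_n\in\mathcal{F}\}$ for any $x\in\mathcal{X}$; it is complete if $\{h(x,y)\colon h\in\mathcal{H}\}=\mathbb{R}$ for any $(x,y)$. The $\mathcal{H}$-estimation error transformation function of a surrogate loss is the tight function $\mathcal{T}$ such that, for all distributions and all $h\in\mathcal{H}$, $\mathcal{T}$ of (zero-one estimation error of $h$ plus zero-one minimizability gap) is at most the surrogate estimation error of $h$ plus the surrogate minimizability gap. For comp-sum losses and symmetric complete $\mathcal{H}$ it is known to be given by the explicit formula displayed in the claim, which is to be taken as the definition of $\mathcal{T}$ here. *)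

theory Defs
  imports "HOL-Analysis.Analysis"
begin

text \<open>
  A hypothesis is a function \<open>h\<close> on pairs \<open>(x, y)\<close> with \<open>x \<in> X\<close> and \<open>y \<in> {1..n}\<close>;
  its values elsewhere play no role. Score vectors \<open>[h(x,1), ..., h(x,n)]\<close> are lists of length \<open>n\<close>.
\<close>

definition symmetric_hyp_set :: "'x set \<Rightarrow> nat \<Rightarrow> ('x \<times> nat \<Rightarrow> real) set \<Rightarrow> bool" where
  "symmetric_hyp_set X n H \<longleftrightarrow>
     (\<exists>F :: ('x \<Rightarrow> real) set. \<forall>x\<in>X.
        {map (\<lambda>y. h (x, y)) [1..<Suc n] | h. h \<in> H} =
        {map (\<lambda>y. f y x) [1..<Suc n] | f. \<forall>y\<in>{1..n}. f y \<in> F})"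

definition complete_hyp_set :: "'x set \<Rightarrow> nat \<Rightarrow> ('x \<times> nat \<Rightarrow> real) set \<Rightarrow> bool" where
  "complete_hyp_set X n H \<longleftrightarrow> (\<forall>x\<in>X. \<forall>y\<in>{1..n}. {h (x, y) | h. h \<in> H} = UNIV)"

text \<open>
  The closed form of the estimation error transformation function of the comp-sum loss of \<open>\<Phi>\<close>
  over a symmetric and complete hypothesis set, for \<open>0 \<le> t \<le> 1\<close>. For \<open>n \<ge> 2\<close> and \<open>\<Phi> \<ge> 0\<close> the real
  supremum and infimum are the genuine ones: the objective is at most \<open>\<Phi> \<tau>\<close> and
  vanishes at \<open>u = 0\<close>, so the suprema exist and are nonnegative.
\<close>

definition comp_sum_transform :: "nat \<Rightarrow> (real \<Rightarrow> real) \<Rightarrow> real \<Rightarrow> real" where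
  "comp_sum_transform n \<Phi> t =
     (INF \<tau>\<in>{1 / real n .. 1 / 2}. SUP u\<in>{u. \<bar>u\<bar> \<le> \<tau>}.
        \<Phi> \<tau> - (1 - t) / 2 * \<Phi> (\<tau> + u) - (1 + t) / 2 * \<Phi> (\<tau> - u))"

end

theory Submission
  imports Defs
begin

text \<open>
  Write the objective at \<open>u = - v\<close> as \<open>t / 2 * (\<Phi> (\<tau> - v) - \<Phi> (\<tau> + v)) - D v\<close>, where \<open>D v\<close> is half the
  second symmetric difference of \<open>\<Phi>\<close> at \<open>\<tau>\<close>. For \<open>\<tau> = 1 / 2\<close> it is nonpositive when \<open>v \<le> 0\<close>, and at
  most \<open>t * L * v - k * v\<^sup>2 \<le> L\<^sup>2 * t\<^sup>2 / (4 * k)\<close> when \<open>v \<ge> 0\<close>. Conversely, for every \<open>\<tau>\<close> the choice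
  \<open>v = s * t\<close> with a small \<open>s\<close> independent of \<open>\<tau>\<close> makes the linear gain dominate \<open>D v\<close>.
\<close>

text \<open>This is \<open>Taylor\<close> with two terms and Lagrange remainder. Locating
  \<open>z\<close> by \<open>closed_segment\<close> treats both signs of \<open>x - c\<close>
  uniformly and admits \<open>x = c\<close>, where \<open>z = c\<close> serves.\<close>

lemma taylor_second_order:
  fixes f f' f'' :: "real \<Rightarrow> real"
  assumes f': "\<And>u. (f has_real_derivative f' u) (at u)"
    and f'': "\<And>u. (f' has_real_derivative f'' u) (at u)"
  obtains z where "z \<in> closed_segment c x"
    and "f x = f c + f' c * (x - c) + f'' z / 2 * (x - c)\<^sup>2"
proof (cases "x = c")
  case True
  then show ?thesis using that[of c] by simp
next
  case False
  \<comment> \<open>The sequence of derivatives that \<open>Taylor\<close> takes; only indices up to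
    2 are consulted, so the value from 3 on is arbitrary.\<close>
  define diff where "diff m = (if m = 0 then f else if m = 1 then f' else f'')" for m :: nat
  have "\<exists>z. (if x < c then x < z \<and> z < c else c < z \<and> z < x) \<and>
     f x = (\<Sum>m<2. diff m c / fact m * (x - c) ^ m) + diff 2 z / fact 2 * (x - c) ^ 2"
    by (rule Taylor[where a = "min x c" and b = "max x c"])
       (use False f' f'' in \<open>auto simp: diff_def less_2_cases_iff\<close>)
  then obtain z where z: "if x < c then x < z \<and> z < c else c < z \<and> z < x"
    "f x = (\<Sum>m<2. diff m c / fact m * (x - c) ^ m) + diff 2 z / fact 2 * (x - c) ^ 2" by blast
  show ?thesis
  proof (rule that)
    show "z \<in> closed_segment c x"
      using z(1) by (auto simp: closed_segment_eq_real_ivl split: if_splits)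
    show "f x = f c + f' c * (x - c) + f'' z / 2 * (x - c)\<^sup>2"
      using z(2) by (simp add: diff_def numeral_2_eq_2)
  qed
qed

definition comp_sum_gap :: "(real \<Rightarrow> real) \<Rightarrow> real \<Rightarrow> real \<Rightarrow> real \<Rightarrow> real" where
  "comp_sum_gap \<Phi> t \<tau> u = \<Phi> \<tau> - (1 - t) / 2 * \<Phi> (\<tau> + u) - (1 + t) / 2 * \<Phi> (\<tau> - u)"

lemma comp_sum_transform_gap:
  "comp_sum_transform n \<Phi> t =
     (INF \<tau>\<in>{1 / real n .. 1 / 2}. SUP u\<in>{u. \<bar>u\<bar> \<le> \<tau>}. comp_sum_gap \<Phi> t \<tau> u)"
  by (simp add: comp_sum_transform_def comp_sum_gap_def)

lemma comp_sum_gap_bdd_above: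
  assumes "\<And>u. \<Phi> u \<ge> 0" and "0 \<le> t" and "t \<le> 1"
  shows "bdd_above (comp_sum_gap \<Phi> t \<tau> ` U)"
proof (rule bdd_aboveI2)
  fix u
  have "0 \<le> (1 - t) / 2 * \<Phi> (\<tau> + u)" and "0 \<le> (1 + t) / 2 * \<Phi> (\<tau> - u)"
    using assms by auto
  then show "comp_sum_gap \<Phi> t \<tau> u \<le> \<Phi> \<tau>"
    by (simp add: comp_sum_gap_def)
qed

text \<open>Curvature is bounded below on \<open>{1/4..1/2}\<close> only, because \<Phi>'' may
  vanish at 0 and a positive minimum needs a compact set away from it. The slope bound covers
  \<open>{0..1}\<close>, which contains every \<open>1/2 - v\<close> and
  \<open>1/2 + v\<close>.\<close>

lemma comp_sum_gap_le_half:
  fixes \<Phi> \<Phi>' \<Phi>'' :: "real \<Rightarrow> real"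
  assumes mono: "antimono \<Phi>" and conv: "convex_on UNIV \<Phi>"
    and d1: "\<And>u. (\<Phi> has_real_derivative \<Phi>' u) (at u)"
    and d2: "\<And>u. (\<Phi>' has_real_derivative \<Phi>'' u) (at u)"
    and a: "a > 0" "\<And>u. u \<in> {1/4..1/2} \<Longrightarrow> a \<le> \<Phi>'' u"
    and L: "\<And>u. u \<in> {0..1} \<Longrightarrow> - \<Phi>' u \<le> L"
    and t: "0 \<le> t" and u: "\<bar>u\<bar> \<le> 1 / 2"
  shows "comp_sum_gap \<Phi> t (1 / 2) u \<le> 2 * L\<^sup>2 / a * t\<^sup>2"
proof (cases "u \<ge> 0")
  case True
  have tangent: "\<Phi> y \<ge> \<Phi> (1/2) + \<Phi>' (1/2) * (y - 1/2)" for y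
    using convex_on_imp_above_tangent[OF conv _ _ _ d1[of "1/2"], of y] by simp
  have "t * \<Phi> (1/2 + u) \<le> t * \<Phi> (1/2 - u)"
    using t True by (intro mult_left_mono antimonoD[OF mono]) auto
  moreover have "\<Phi> (1/2 + u) + \<Phi> (1/2 - u) \<ge> 2 * \<Phi> (1/2)"
    using tangent[of "1/2 + u"] tangent[of "1/2 - u"] by simp
  ultimately have "comp_sum_gap \<Phi> t (1/2) u \<le> 0"
    by (simp add: comp_sum_gap_def field_simps)
  also have "0 \<le> 2 * L\<^sup>2 / a * t\<^sup>2" using a by simp
  finally show ?thesis .
next
  case False
  define v where "v = - u"
  have v: "0 < v" "v \<le> 1/2" and u_eq: "u = - v" using False u by (auto simp: v_def)
  have right: "\<Phi> (1/2 + v) \<ge> \<Phi> (1/2) + \<Phi>' (1/2) * v"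
    using convex_on_imp_above_tangent[OF conv _ _ _ d1[of "1/2"], of "1/2 + v"] by simp
  \<comment> \<open>The curvature bound holds only on \<open>[1/4, 1/2]\<close>, so it is applied at \<open>1/2 - v/2\<close> and carried over
    to \<open>1/2 - v\<close> by midpoint convexity.\<close>
  obtain z where z: "z \<in> closed_segment (1/2) (1/2 - v/2)"
    "\<Phi> (1/2 - v/2) = \<Phi> (1/2) + \<Phi>' (1/2) * (1/2 - v/2 - 1/2) + \<Phi>'' z / 2 * (1/2 - v/2 - 1/2)\<^sup>2"
    using taylor_second_order[OF d1 d2] by blast
  have "a \<le> \<Phi>'' z" using z(1) v by (intro a) (auto simp: closed_segment_eq_real_ivl)
  then have "a * v\<^sup>2 \<le> \<Phi>'' z * v\<^sup>2" by (simp add: mult_right_mono)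
  then have mid: "\<Phi> (1/2 - v/2) \<ge> \<Phi> (1/2) - \<Phi>' (1/2) * v / 2 + a * v\<^sup>2 / 8"
    using z(2) by (simp add: power2_eq_square field_simps)
  have "\<Phi> (1/2 - v/2) \<le> \<Phi> (1/2) / 2 + \<Phi> (1/2 - v) / 2"
  proof -
    have "1/2 - v/2 = (1 - 1/2) *\<^sub>R (1/2) + (1/2) *\<^sub>R (1/2 - v)" by (simp add: field_simps)
    then show ?thesis using convex_onD[OF conv, of "1/2" "1/2" "1/2 - v"] by simp
  qed
  with mid have left: "\<Phi> (1/2 - v) \<ge> \<Phi> (1/2) - \<Phi>' (1/2) * v + a * v\<^sup>2 / 4" by simp
  obtain w where w: "1/2 - v < w" "w < 1/2 + v"
    "\<Phi> (1/2 + v) - \<Phi> (1/2 - v) = (1/2 + v - (1/2 - v)) * \<Phi>' w"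
    using MVT2[of "1/2 - v" "1/2 + v" \<Phi> \<Phi>'] v d1 by auto
  have "- \<Phi>' w \<le> L" using w(1,2) v by (intro L) auto
  then have "2 * v * - \<Phi>' w \<le> 2 * v * L" using v by (intro mult_left_mono) auto
  then have "\<Phi> (1/2 - v) - \<Phi> (1/2 + v) \<le> 2 * v * L"
    using w(3) by (simp add: algebra_simps)
  then have lin: "t * (\<Phi> (1/2 - v) - \<Phi> (1/2 + v)) \<le> t * (2 * v * L)"
    using t by (rule mult_left_mono)
  have "2 * comp_sum_gap \<Phi> t (1/2) u = 2 * \<Phi> (1/2) - \<Phi> (1/2 + v) - \<Phi> (1/2 - v)
      + t * (\<Phi> (1/2 - v) - \<Phi> (1/2 + v))"
    by (simp add: comp_sum_gap_def u_eq field_simps)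
  also have "\<dots> \<le> t * (2 * v * L) - a * v\<^sup>2 / 4" using right left lin by linarith
  also have "\<dots> \<le> 4 * L\<^sup>2 / a * t\<^sup>2"
  proof -
    \<comment> \<open>Completing the square: \<open>2 * L * t * v - a * v^2 / 4\<close> is largest
      at \<open>v = 4 * L * t / a\<close>.\<close>
    have "0 \<le> (a * v / 2 - 2 * L * t)\<^sup>2 / a" using a by simp
    then show ?thesis using a by (simp add: power2_eq_square field_simps)
  qed
  finally show ?thesis by simp
qed

text \<open>The first-order Taylor terms at \<open>\<tau> + v\<close> and \<open>\<tau> - v\<close>
  cancel, leaving a quadratic loss against a linear gain. Since \<open>b\<close> and
  \<open>A\<close> do not depend on \<tau>, the bound survives the infimum.\<close>

lemma comp_sum_gap_ge:
  fixes \<Phi> \<Phi>' \<Phi>'' :: "real \<Rightarrow> real"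
  assumes mono: "antimono \<Phi>"
    and d1: "\<And>u. (\<Phi> has_real_derivative \<Phi>' u) (at u)"
    and d2: "\<And>u. (\<Phi>' has_real_derivative \<Phi>'' u) (at u)"
    and b: "\<And>u. 0 < u \<Longrightarrow> u \<le> 1 / 2 \<Longrightarrow> \<Phi>' u \<le> - b"
    and A: "\<And>u. u \<in> {0..1} \<Longrightarrow> \<Phi>'' u \<le> A"
    and v: "0 < v" "v \<le> \<tau>" and \<tau>: "\<tau> \<le> 1 / 2" and t: "0 \<le> t"
  shows "comp_sum_gap \<Phi> t \<tau> (- v) \<ge> t * b * v / 2 - A * v\<^sup>2 / 2"
proof -
  have quad: "\<Phi> (\<tau> + h) \<le> \<Phi> \<tau> + \<Phi>' \<tau> * h + A * v\<^sup>2 / 2" if h: "\<bar>h\<bar> = v" for h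
  proof -
    obtain z where z: "z \<in> closed_segment \<tau> (\<tau> + h)"
      "\<Phi> (\<tau> + h) = \<Phi> \<tau> + \<Phi>' \<tau> * (\<tau> + h - \<tau>) + \<Phi>'' z / 2 * (\<tau> + h - \<tau>)\<^sup>2"
      using taylor_second_order[OF d1 d2] by blast
    have "\<Phi>'' z \<le> A"
      using z(1) v \<tau> h by (intro A) (auto simp: closed_segment_eq_real_ivl split: if_splits)
    moreover have "h\<^sup>2 = v\<^sup>2" using h by (metis power2_abs)
    ultimately show ?thesis using z(2) by (simp add: mult_right_mono)
  qed
  \<comment> \<open>The slope bound \<open>b\<close> holds on (0, 1/2] only, so the drop is measured
    left of \<tau>, and monotonicity handles the right. The strict \<open>\<tau> - v < w\<close>
    keeps \<open>w\<close> positive even for \<open>v = \<tau>\<close>.\<close>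
  obtain w where w: "\<tau> - v < w" "w < \<tau>" "\<Phi> \<tau> - \<Phi> (\<tau> - v) = (\<tau> - (\<tau> - v)) * \<Phi>' w"
    using MVT2[of "\<tau> - v" \<tau> \<Phi> \<Phi>'] v d1 by auto
  have "v * \<Phi>' w \<le> v * - b" using w v \<tau> by (intro mult_left_mono b) auto
  moreover have "\<Phi> (\<tau> + v) \<le> \<Phi> \<tau>" using v by (intro antimonoD[OF mono]) auto
  ultimately have "b * v \<le> \<Phi> (\<tau> - v) - \<Phi> (\<tau> + v)" using w(3) by (simp add: mult.commute)
  then have "t * (b * v) \<le> t * (\<Phi> (\<tau> - v) - \<Phi> (\<tau> + v))" using t by (rule mult_left_mono)
  moreover have "2 * comp_sum_gap \<Phi> t \<tau> (- v) =
      2 * \<Phi> \<tau> - \<Phi> (\<tau> + v) - \<Phi> (\<tau> - v) + t * (\<Phi> (\<tau> - v) - \<Phi> (\<tau> + v))"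
    by (simp add: comp_sum_gap_def field_simps)
  moreover have "\<Phi> (\<tau> + v) + \<Phi> (\<tau> - v) \<le> 2 * \<Phi> \<tau> + A * v\<^sup>2"
    using quad[of v] quad[of "- v"] v by simp
  ultimately show ?thesis by simp
qed

theorem theorem8:
  fixes n :: nat
    and M :: "'x measure"
    and H :: "('x \<times> nat \<Rightarrow> real) set"
    and \<Phi> \<Phi>' \<Phi>'' :: "real \<Rightarrow> real"
  assumes "n \<ge> 2"
    and "H \<subseteq> borel_measurable (M \<Otimes>\<^sub>M count_space {1..n})"
    and "symmetric_hyp_set (space M) n H"
    and "complete_hyp_set (space M) n H"
    and "\<And>u. \<Phi> u \<ge> 0"
    and "antimono \<Phi>"
    and "convex_on UNIV \<Phi>"
    and "\<And>u. (\<Phi> has_real_derivative \<Phi>' u) (at u)"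
    and "\<And>u. (\<Phi>' has_real_derivative \<Phi>'' u) (at u)"
    and "continuous_on UNIV \<Phi>''"
    and "\<And>u. 0 < u \<Longrightarrow> u \<le> 1 / 2 \<Longrightarrow> \<Phi>' u < 0"
    and "\<And>u. 0 < u \<Longrightarrow> u \<le> 1 / 2 \<Longrightarrow> \<Phi>'' u > 0"
  shows "\<exists>C > 0. \<exists>c > 0. \<exists>T > 0. T \<le> 1 \<and>
           (\<forall>t. 0 < t \<and> t \<le> T \<longrightarrow>
              C * t\<^sup>2 \<ge> comp_sum_transform n \<Phi> t \<and> comp_sum_transform n \<Phi> t \<ge> c * t\<^sup>2)"
proof -
  note nonneg = assms(5) and mono = assms(6) and conv = assms(7) and d1 = assms(8)
    and d2 = assms(9) and cont = assms(10) and neg = assms(11) and pos = assms(12)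
  have cont': "continuous_on S \<Phi>''" for S using cont by (rule continuous_on_subset) simp
  obtain p where p: "p \<in> {1/4..1/2}" "\<forall>u\<in>{1/4..1/2}. \<Phi>'' p \<le> \<Phi>'' u"
    using continuous_attains_inf[OF compact_Icc _ cont', of "1/4" "1/2"] by auto
  define a where "a = \<Phi>'' p"
  have a: "a > 0" "\<And>u. u \<in> {1/4..1/2} \<Longrightarrow> a \<le> \<Phi>'' u" using p pos[of p] by (auto simp: a_def)
  obtain q where q: "\<forall>u\<in>{0..1}. \<Phi>'' u \<le> \<Phi>'' q"
    using continuous_attains_sup[OF compact_Icc _ cont', of 0 1] by auto
  define A where "A = \<Phi>'' q"
  have A: "\<And>u. u \<in> {0..1} \<Longrightarrow> \<Phi>'' u \<le> A" using q by (auto simp: A_def)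
  have A_pos: "A > 0" using A[of "1/2"] pos[of "1/2"] by simp
  have "continuous_on {0..1} (\<lambda>u. - \<Phi>' u)"
    by (intro continuous_on_minus continuous_at_imp_continuous_on ballI DERIV_isCont[OF d2])
  then obtain r where r: "\<forall>u\<in>{0..1}. - \<Phi>' u \<le> - \<Phi>' r"
    using continuous_attains_sup[OF compact_Icc, of 0 1 "\<lambda>u. - \<Phi>' u"] by auto
  define L where "L = - \<Phi>' r"
  have L: "\<And>u. u \<in> {0..1} \<Longrightarrow> - \<Phi>' u \<le> L" using r by (auto simp: L_def)
  have L_pos: "L > 0" using L[of "1/2"] neg[of "1/2"] by simp
  \<comment> \<open>\<Phi>' increases on (0, 1/2] because \<Phi>'' is positive there, so the descent
    is slowest at the right endpoint.\<close>
  define b where "b = - \<Phi>' (1/2)"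
  have b_pos: "b > 0" using neg[of "1/2"] by (simp add: b_def)
  have b: "\<Phi>' u \<le> - b" if "0 < u" "u \<le> 1/2" for u
    unfolding b_def minus_minus
  proof (rule DERIV_nonneg_imp_nondecreasing[OF that(2)])
    fix x assume "u \<le> x" "x \<le> 1/2"
    then show "\<exists>y. (\<Phi>' has_real_derivative y) (at x) \<and> 0 \<le> y"
      using d2[of x] pos[of x] that by force
  qed
  \<comment> \<open>The first bound keeps the quadratic loss at \<open>v = s * t\<close> within half
    of the linear gain; the second gives \<open>s * t \<le> 1 / real n \<le> \<tau>\<close>, so that
    this \<open>v\<close> is admissible for every \<tau>.\<close>
  define s where "s = min (b / (2 * A)) (1 / real n)"
  have s: "0 < s" "s \<le> 1 / real n" "A * s \<le> b / 2"
  proof -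
    show "0 < s" "s \<le> 1 / real n" using b_pos A_pos \<open>n \<ge> 2\<close> by (auto simp: s_def)
    have "s \<le> b / (2 * A)" by (simp add: s_def)
    then show "A * s \<le> b / 2" using A_pos by (simp add: field_simps)
  qed
  have half: "1 / 2 \<in> {1 / real n..1 / 2}" using \<open>n \<ge> 2\<close> by (simp add: field_simps)
  have upper: "comp_sum_transform n \<Phi> t \<le> 2 * L\<^sup>2 / a * t\<^sup>2" if t: "0 < t" "t \<le> 1" for t
  proof -
    \<comment> \<open>\<open>cINF_lower\<close> requires a lower bound: the objective vanishes at
      \<open>u = 0\<close>, so each supremum is nonnegative.\<close>
    have "bdd_below ((\<lambda>\<tau>. SUP u\<in>{u. \<bar>u\<bar> \<le> \<tau>}. comp_sum_gap \<Phi> t \<tau> u) ` {1 / real n..1 / 2})"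
    proof (rule bdd_belowI2)
      fix \<tau> assume "\<tau> \<in> {1 / real n..1 / 2}"
      then have "0 \<le> \<tau>" by (auto intro: order_trans[rotated])
      then have "comp_sum_gap \<Phi> t \<tau> 0 \<le> (SUP u\<in>{u. \<bar>u\<bar> \<le> \<tau>}. comp_sum_gap \<Phi> t \<tau> u)"
        using t by (intro cSUP_upper comp_sum_gap_bdd_above nonneg) auto
      then show "0 \<le> (SUP u\<in>{u. \<bar>u\<bar> \<le> \<tau>}. comp_sum_gap \<Phi> t \<tau> u)"
        by (simp add: comp_sum_gap_def field_simps)
    qed
    then have "comp_sum_transform n \<Phi> t \<le> (SUP u\<in>{u. \<bar>u\<bar> \<le> 1/2}. comp_sum_gap \<Phi> t (1/2) u)"
      unfolding comp_sum_transform_gap by (rule cINF_lower) (rule half)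
    also have "\<dots> \<le> 2 * L\<^sup>2 / a * t\<^sup>2"
    proof (rule cSUP_least)
      show "{u::real. \<bar>u\<bar> \<le> 1/2} \<noteq> {}" by (auto intro: exI[of _ 0])
      show "comp_sum_gap \<Phi> t (1/2) u \<le> 2 * L\<^sup>2 / a * t\<^sup>2" if "u \<in> {u. \<bar>u\<bar> \<le> 1/2}" for u
        using comp_sum_gap_le_half[OF mono conv d1 d2 a L] t that by simp
    qed
    finally show ?thesis .
  qed
  have lower: "s * b / 4 * t\<^sup>2 \<le> comp_sum_transform n \<Phi> t" if t: "0 < t" "t \<le> 1" for t
    unfolding comp_sum_transform_gap
  proof (rule cINF_greatest)
    show "{1 / real n..1 / 2} \<noteq> {}" using half by blast
    fix \<tau> assume \<tau>: "\<tau> \<in> {1 / real n..1 / 2}"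
    have "s * t \<le> s" using t s(1) by (simp add: mult_left_le)
    also note s(2)
    also have "1 / real n \<le> \<tau>" using \<tau> by simp
    finally have v: "0 < s * t" "s * t \<le> \<tau>" using s(1) t by auto
    \<comment> \<open>The gain is \<open>s * b / 2 * t^2\<close> and the loss at most half of it,
      which leaves the constant \<open>s * b / 4\<close>.\<close>
    have "s * t\<^sup>2 * (A * s) \<le> s * t\<^sup>2 * (b / 2)"
      using s by (intro mult_left_mono) auto
    then have "s * b / 4 * t\<^sup>2 \<le> t * b * (s * t) / 2 - A * (s * t)\<^sup>2 / 2"
      by (simp add: power2_eq_square field_simps)
    also have "\<dots> \<le> comp_sum_gap \<Phi> t \<tau> (- (s * t))"
      using comp_sum_gap_ge[OF mono d1 d2 b A v] t \<tau> by simp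
    also have "\<dots> \<le> (SUP u\<in>{u. \<bar>u\<bar> \<le> \<tau>}. comp_sum_gap \<Phi> t \<tau> u)"
      using t v by (intro cSUP_upper comp_sum_gap_bdd_above nonneg) auto
    finally show "s * b / 4 * t\<^sup>2 \<le> (SUP u\<in>{u. \<bar>u\<bar> \<le> \<tau>}. comp_sum_gap \<Phi> t \<tau> u)" .
  qed
  have "2 * L\<^sup>2 / a > 0" "s * b / 4 > 0" using a L_pos s b_pos by auto
  with upper lower show ?thesis
    \<comment> \<open>Both bounds hold on all of (0, 1], hence \<open>T = 1\<close>.\<close>
    by (intro exI[of _ "2 * L\<^sup>2 / a"] exI[of _ "s * b / 4"] exI[of _ 1] conjI allI impI) auto
qed

end
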